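(* Let $m$ be a positive integer. Then $m\leq\overset{\rightarrow}{\Gamma}_{LD}(K_m\Box K_m)\leq 3m\log(m+1)$.
   Context: $K_m\Box K_m$ is the Cartesian product of two complete graphs on $m$ vertices: vertices $(v_i,u_j)$, $1\leq i,j\leq m$, with $(v_{i_1},u_{j_1})$ adjacent to $(v_{i_2},u_{j_2})$ iff they are distinct and $i_1=i_2$ or $j_1=j_2$. Logarithms are base 2. For an orientation $D$ of a graph $G=(V,E)$, $S\subseteq V$ is locating-dominating in $D$ if every $u\notin S$ has an in-neighbour in $S$ and distinct $u,v\notin S$ have distinct sets of in-neighbours in $S$; $\gamma_{LD}(D)$ is the minimum size. $\overset{\rightarrow}{\Gamma}_{LD}(G)=\max_D\gamma_{LD}(D)$ over all orientations $D$ of $G$. *)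

theory Defs
  imports Complex_Main "Graph_Theory.Kuratowski"
begin

text \<open>
  Following the conventions of \<^theory>\<open>Graph_Theory.Digraph\<close>, an undirected graph is a
  symmetric digraph: an edge $uv$ is represented by the two arcs $(u,v)$ and $(v,u)$.
\<close>

definition complete_pair_graph :: "nat \<Rightarrow> nat pair_pre_digraph" where
  "complete_pair_graph n =
    \<lparr> pverts = {1..n}, parcs = {(u, v). u \<in> {1..n} \<and> v \<in> {1..n} \<and> u \<noteq> v} \<rparr>"

definition cartesian_product ::
    "'a pair_pre_digraph \<Rightarrow> 'b pair_pre_digraph \<Rightarrow> ('a \<times> 'b) pair_pre_digraph"
    (infixr \<open>\<box>\<close> 80) where
  "G \<box> H =
    \<lparr> pverts = pverts G \<times> pverts H,
      parcs = {((g, h), (g', h')).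
        g = g' \<and> g \<in> pverts G \<and> (h, h') \<in> parcs H \<or>
        h = h' \<and> h \<in> pverts H \<and> (g, g') \<in> parcs G} \<rparr>"

lemma complete_digraph_complete_pair_graph: "K\<^bsub>n\<^esub> (with_proj (complete_pair_graph n))"
  unfolding complete_digraph_pair_def by (auto simp: complete_pair_graph_def)

lemma parcs_complete_box_complete:
  "((i1, j1), (i2, j2)) \<in> parcs (complete_pair_graph m \<box> complete_pair_graph m) \<longleftrightarrow>
    i1 \<in> {1..m} \<and> j1 \<in> {1..m} \<and> i2 \<in> {1..m} \<and> j2 \<in> {1..m} \<and>
    (i1, j1) \<noteq> (i2, j2) \<and> (i1 = i2 \<or> j1 = j2)"
  by (auto simp: cartesian_product_def complete_pair_graph_def)

definition orientation_of :: "'a pair_pre_digraph \<Rightarrow> 'a pair_pre_digraph \<Rightarrow> bool" where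
  "orientation_of D G \<longleftrightarrow>
    pverts D = pverts G \<and> parcs D \<subseteq> parcs G \<and>
    (\<forall>(u, v) \<in> parcs G. (u, v) \<in> parcs D \<longleftrightarrow> (v, u) \<notin> parcs D)"

definition in_neighbours :: "'a pair_pre_digraph \<Rightarrow> 'a \<Rightarrow> 'a set" where
  "in_neighbours D v = {u. (u, v) \<in> parcs D}"

definition locating_dominating :: "'a pair_pre_digraph \<Rightarrow> 'a set \<Rightarrow> bool" where
  "locating_dominating D S \<longleftrightarrow>
    S \<subseteq> pverts D \<and>
    (\<forall>u \<in> pverts D - S. in_neighbours D u \<inter> S \<noteq> {}) \<and>
    (\<forall>u \<in> pverts D - S. \<forall>v \<in> pverts D - S.
      u \<noteq> v \<longrightarrow> in_neighbours D u \<inter> S \<noteq> in_neighbours D v \<inter> S)"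

definition gamma_LD :: "'a pair_pre_digraph \<Rightarrow> nat" where
  "gamma_LD D = Min {card S | S. locating_dominating D S}"

definition Gamma_LD :: "'a pair_pre_digraph \<Rightarrow> nat" where
  "Gamma_LD G = Max {gamma_LD D | D. orientation_of D G}"

text \<open>
  The minimum and the maximum above range over finite nonempty sets when the
  graph is finite; \<^const>\<open>Min\<close> and \<^const>\<open>Max\<close> are unspecified otherwise.
\<close>

lemma finite_nonempty_locating_dominating:
  assumes "finite (pverts D)"
  shows "finite {card S | S. locating_dominating D S}"
    and "{card S | S. locating_dominating D S} \<noteq> {}"
proof -
  have "{card S | S. locating_dominating D S} \<subseteq> card ` Pow (pverts D)"
    by (auto simp: locating_dominating_def)
  then show "finite {card S | S. locating_dominating D S}"
    using assms by (meson finite_Pow_iff finite_imageI finite_subset)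
  have "locating_dominating D (pverts D)"
    by (simp add: locating_dominating_def)
  then show "{card S | S. locating_dominating D S} \<noteq> {}" by blast
qed

lemma finite_nonempty_orientations:
  assumes "pair_graph G"
  shows "finite {gamma_LD D | D. orientation_of D G}"
    and "{gamma_LD D | D. orientation_of D G} \<noteq> {}"
proof -
  interpret pair_graph G by fact
  have "{gamma_LD D | D. orientation_of D G} \<subseteq>
      (\<lambda>A. gamma_LD \<lparr> pverts = pverts G, parcs = A \<rparr>) ` Pow (parcs G)"
  proof safe
    fix D assume "orientation_of D G"
    then have "D = \<lparr> pverts = pverts G, parcs = parcs D \<rparr>" and "parcs D \<in> Pow (parcs G)"
      by (cases D; simp add: orientation_of_def)+
    then show "gamma_LD D \<in> (\<lambda>A. gamma_LD \<lparr> pverts = pverts G, parcs = A \<rparr>) ` Pow (parcs G)"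
      by (metis imageI)
  qed
  then show "finite {gamma_LD D | D. orientation_of D G}"
    using pair_finite_arcs by (meson finite_Pow_iff finite_imageI finite_subset)
  obtain f :: "'a \<Rightarrow> nat" where f: "inj_on f (pverts G)"
    using finite_imp_inj_to_nat_seg[OF pair_finite_verts] by blast
  have neq: "f u \<noteq> f v" and rev: "(v, u) \<in> parcs G"
    if uv: "(u, v) \<in> parcs G" for u v
  proof -
    have "u \<noteq> v" "u \<in> pverts G" "v \<in> pverts G"
      using pair_no_loops[OF uv] in_arcsD1[OF uv] in_arcsD2[OF uv] by auto
    then show "f u \<noteq> f v" using inj_onD[OF f] by blast
    show "(v, u) \<in> parcs G"
      using arcs_ends_symmetric[OF pair_sym_arcs, of u v] uv by simp
  qed
  have "orientation_of \<lparr> pverts = pverts G, parcs = {(u, v). (u, v) \<in> parcs G \<and> f u < f v} \<rparr> G"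
    unfolding orientation_of_def 
  proof (intro conjI ballI; clarsimp)
    fix u v assume uv: "(u, v) \<in> parcs G"
    show "f u < f v \<longleftrightarrow> ((v, u) \<in> parcs G \<longrightarrow> \<not> f v < f u)"
      using neq[OF uv] rev[OF uv] by linarith
  qed
  then show "{gamma_LD D | D. orientation_of D G} \<noteq> {}" by blast
qed

end

theory Submission
  imports Defs
begin

text \<open>
  Lower bound: a set of fewer than \<open>m\<close> vertices misses a whole row and a whole column, so their
  common vertex is not dominated, whatever the orientation.

  Upper bound: a tournament on \<open>n\<close> vertices has a dominating set of size at most
  \<open>log 2 (n + 1)\<close>. Take one such set in every column; in every row take one such set and a second
  one for the rest of the row. Each vertex outside their union \<open>S\<close> then has two in-neighbours from
  \<open>S\<close> in its row, which determine the row, and one in its column, which determines the column.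
\<close>

text \<open>Averaging over all vertices: of the two ordered pairs formed by distinct
  \<open>u\<close>, \<open>v\<close>, at most one is a failure of \<open>R\<close>. So fewer than
  half of all pairs in \<open>V \<times> V\<close> are failures, and they cannot amount to
  \<open>card V / 2\<close> or more at every vertex.\<close>

lemma tournament_exists_large_outdegree:
  assumes "finite V" "V \<noteq> {}"
    and tour: "\<And>u v. \<lbrakk>u \<in> V; v \<in> V; u \<noteq> v\<rbrakk> \<Longrightarrow> R u v \<or> R v u"
  shows "\<exists>v\<in>V. 2 * card {u \<in> V - {v}. \<not> R v u} + 1 \<le> card V"
proof (rule ccontr)
  assume "\<not> ?thesis"
  then have large: "card V \<le> 2 * card {u \<in> V - {v}. \<not> R v u}" if "v \<in> V" for v
    using that by fastforce
  define P where "P = (SIGMA v:V. {u \<in> V - {v}. \<not> R v u})"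
  have fin: "finite P" using assms(1) by (auto simp: P_def)
  have "P \<inter> P\<inverse> = {}" using tour by (auto simp: P_def)
  then have "card (P \<union> P\<inverse>) = 2 * card P"
    using fin by (simp add: card_Un_disjoint card_inverse)
  \<comment> \<open>The inclusion is strict because the diagonal is left out and \<open>V\<close> is
    nonempty; this supplies the strict inequality for the contradiction.\<close>
  moreover have "P \<union> P\<inverse> \<subset> V \<times> V" using assms(2) by (auto simp: P_def)
  ultimately have "2 * card P < card V * card V"
    using assms(1) by (metis card_cartesian_product finite_SigmaI psubset_card_mono)
  moreover have "card V * card V \<le> (\<Sum>v\<in>V. 2 * card {u \<in> V - {v}. \<not> R v u})"
    using sum_mono[of V "\<lambda>_. card V", OF large] by simp
  moreover have "(\<Sum>v\<in>V. 2 * card {u \<in> V - {v}. \<not> R v u}) = 2 * card P"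
    using assms(1) by (simp add: P_def sum_distrib_left)
  ultimately show False by simp
qed

text \<open>Greedy choice: pick the vertex of the previous lemma, then recurse on the vertices it
  fails to dominate, which are fewer than half. The form \<open>card V + 1\<close> fits the
  recursion and gives \<open>1 \<le> 1\<close> for the empty set.\<close>

lemma tournament_dominating_set:
  assumes "finite V"
    and "\<And>u v. \<lbrakk>u \<in> V; v \<in> V; u \<noteq> v\<rbrakk> \<Longrightarrow> R u v \<or> R v u"
  shows "\<exists>A\<subseteq>V. 2 ^ card A \<le> card V + 1 \<and> (\<forall>v\<in>V - A. \<exists>a\<in>A. R a v)"
  using assms
proof (induction "card V" arbitrary: V rule: less_induct)
  case less
  show ?case
  proof (cases "V = {}")
    case False
    then obtain v where v: "v \<in> V" "2 * card {u \<in> V - {v}. \<not> R v u} + 1 \<le> card V"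
      using tournament_exists_large_outdegree[of V R] less.prems by blast
    define W where "W = {u \<in> V - {v}. \<not> R v u}"
    have "card W < card V" using v by (simp add: W_def)
    moreover have "finite W" "W \<subseteq> V" using less.prems(1) by (auto simp: W_def)
    ultimately obtain A where A: "A \<subseteq> W" "2 ^ card A \<le> card W + 1"
      "\<forall>u\<in>W - A. \<exists>a\<in>A. R a u"
      using less.hyps[of W] less.prems(2) by (meson subsetD)
    have "finite A" "v \<notin> A" using A(1) \<open>finite W\<close> by (auto simp: W_def intro: finite_subset)
    \<comment> \<open>One more vertex doubles the power:
      \<open>2 * 2 ^ card A \<le> 2 * card W + 2 \<le> card V + 1\<close>.\<close>
    then have "2 ^ card (insert v A) \<le> card V + 1" using A(2) v(2) by (simp add: W_def)
    moreover have "\<forall>u\<in>V - insert v A. \<exists>a\<in>insert v A. R a u"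
      using A(3) by (auto simp: W_def)
    moreover have "insert v A \<subseteq> V" using A(1) v(1) \<open>W \<subseteq> V\<close> by blast
    ultimately show ?thesis by blast
  qed simp
qed

text \<open>The bound depends on \<open>m\<close> instead of \<open>card V\<close>, so that it
  serves whole rows, whole columns and remainders of rows alike.\<close>

lemma tournament_dominating_set_log:
  assumes "V \<subseteq> {1..m::nat}"
    and "\<And>u v. \<lbrakk>u \<in> V; v \<in> V; u \<noteq> v\<rbrakk> \<Longrightarrow> R u v \<or> R v u"
  shows "\<exists>A\<subseteq>V. real (card A) \<le> log 2 (real m + 1) \<and> (\<forall>v\<in>V - A. \<exists>a\<in>A. R a v)"
proof -
  have "finite V" using assms(1) finite_subset by blast
  then obtain A where A: "A \<subseteq> V" "2 ^ card A \<le> card V + 1" "\<forall>v\<in>V - A. \<exists>a\<in>A. R a v"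
    using tournament_dominating_set[of V R] assms(2) by blast
  have "card V \<le> m" using card_mono[OF _ assms(1)] by simp
  then have "2 ^ card A \<le> m + 1" using A(2) by linarith
  then have "2 ^ card A \<le> real m + 1"
    using of_nat_mono[of "2 ^ card A" "m + 1", where 'a = real] by simp
  then have "real (card A) \<le> log 2 (real m + 1)" by (intro le_log_of_power) auto
  then show ?thesis using A by blast
qed

lemma pverts_complete_box_complete:
  "pverts (complete_pair_graph m \<box> complete_pair_graph m) = {1..m} \<times> {1..m}"
  by (simp add: cartesian_product_def complete_pair_graph_def)

lemma pair_graph_complete_box_complete:
  "pair_graph (complete_pair_graph m \<box> complete_pair_graph m)" (is "pair_graph ?G")
proof -
  have sub: "parcs ?G \<subseteq> pverts ?G \<times> pverts ?G"
    by (auto simp: parcs_complete_box_complete pverts_complete_box_complete)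
  have fin: "finite (pverts ?G)" by (simp add: pverts_complete_box_complete)
  show ?thesis
  proof
    show "finite (parcs ?G)" using sub fin finite_subset by blast
    show "symmetric (with_proj ?G)"
      unfolding symmetric_def
      by (auto intro!: symI simp: arcs_ends_conv parcs_complete_box_complete)
  qed (use sub fin in \<open>auto simp: parcs_complete_box_complete\<close>)
qed

lemma locating_dominating_card_ge:
  assumes D: "orientation_of D (complete_pair_graph m \<box> complete_pair_graph m)"
    and S: "locating_dominating D S"
  shows "m \<le> card S"
proof (rule ccontr)
  assume "\<not> ?thesis"
  then have small: "card S < m" by simp
  have vD: "pverts D = {1..m} \<times> {1..m}"
    using D by (simp add: orientation_of_def pverts_complete_box_complete)
  then have fin: "finite S"
    using S by (metis finite_SigmaI finite_atLeastAtMost finite_subset locating_dominating_def)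
  \<comment> \<open>Stated for arbitrary \<open>f\<close> so that \<open>fst\<close> yields the
    missed row and \<open>snd\<close> the missed column.\<close>
  have missed: "\<exists>i\<in>{1..m}. i \<notin> f ` S" for f :: "nat \<times> nat \<Rightarrow> nat"
  proof (rule ccontr)
    assume "\<not> ?thesis"
    then have "card {1..m} \<le> card (f ` S)" using fin by (intro card_mono) auto
    then show False using card_image_le[OF fin, of f] small by simp
  qed
  obtain i j where ij: "i \<in> {1..m}" "i \<notin> fst ` S" "j \<in> {1..m}" "j \<notin> snd ` S"
    using missed[of fst] missed[of snd] by blast
  then have "(i, j) \<in> pverts D - S" using vD by force
  then have "in_neighbours D (i, j) \<inter> S \<noteq> {}"
    using S unfolding locating_dominating_def by blast
  then obtain a b where ab: "(a, b) \<in> S" "((a, b), (i, j)) \<in> parcs D"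
    by (auto simp: in_neighbours_def)
  \<comment> \<open>Every in-neighbour shares a coordinate with \<open>(i, j)\<close>, so it lies in
    the missed row or in the missed column.\<close>
  then have "a = i \<or> b = j"
    using D parcs_complete_box_complete unfolding orientation_of_def by blast
  then show False using ij ab(1) by force
qed

text \<open>The factor 3 counts two tournament dominating sets per row and one per column.\<close>

lemma exists_small_locating_dominating:
  assumes D: "orientation_of D (complete_pair_graph m \<box> complete_pair_graph m)"
  shows "\<exists>S. locating_dominating D S \<and> real (card S) \<le> 3 * real m * log 2 (real m + 1)"
proof -
  let ?I = "{1..m}"
  let ?L = "log 2 (real m + 1)"
  have vD: "pverts D = ?I \<times> ?I"
    using D by (simp add: orientation_of_def pverts_complete_box_complete)
  have adj: "(i, j) \<noteq> (i', j') \<and> (i = i' \<or> j = j')" if "((i, j), (i', j')) \<in> parcs D" for i j i' j'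
    using D that parcs_complete_box_complete unfolding orientation_of_def by blast
  have tour: "((i, j), (i', j')) \<in> parcs D \<or> ((i', j'), (i, j)) \<in> parcs D"
    if "i \<in> ?I" "j \<in> ?I" "i' \<in> ?I" "j' \<in> ?I" "(i, j) \<noteq> (i', j')" "i = i' \<or> j = j'" for i j i' j'
  proof -
    have "((i, j), (i', j')) \<in> parcs (complete_pair_graph m \<box> complete_pair_graph m)"
      using that by (simp only: parcs_complete_box_complete) blast
    then show ?thesis using D unfolding orientation_of_def by blast
  qed
  have dom_row: "\<exists>A\<subseteq>V. real (card A) \<le> ?L \<and> (\<forall>j\<in>V - A. \<exists>a\<in>A. ((i, a), (i, j)) \<in> parcs D)"
    if "i \<in> ?I" "V \<subseteq> ?I" for i V
  proof (rule tournament_dominating_set_log[OF that(2)])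
    fix u v assume "u \<in> V" "v \<in> V" "u \<noteq> v"
    then show "((i, u), (i, v)) \<in> parcs D \<or> ((i, v), (i, u)) \<in> parcs D"
      by (intro tour) (use that in auto)
  qed
  have dom_col: "\<exists>C\<subseteq>?I. real (card C) \<le> ?L \<and> (\<forall>i\<in>?I - C. \<exists>c\<in>C. ((c, j), (i, j)) \<in> parcs D)"
    if "j \<in> ?I" for j
    using that tour by (intro tournament_dominating_set_log) auto
  obtain A where A: "A i \<subseteq> ?I" "real (card (A i)) \<le> ?L"
    "\<forall>j\<in>?I - A i. \<exists>a\<in>A i. ((i, a), (i, j)) \<in> parcs D" if "i \<in> ?I" for i
    using dom_row[of _ ?I] by (metis order_refl)
  \<comment> \<open>Choosing the second set outside \<open>A i\<close> guarantees that the two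
    in-neighbours found later in a row are distinct.\<close>
  have dom_rest: "\<exists>B\<subseteq>?I - A i. real (card B) \<le> ?L \<and>
      (\<forall>j\<in>?I - A i - B. \<exists>b\<in>B. ((i, b), (i, j)) \<in> parcs D)"
    if "i \<in> ?I" for i
    using that by (intro dom_row) auto
  obtain B where B: "B i \<subseteq> ?I - A i" "real (card (B i)) \<le> ?L"
    "\<forall>j\<in>?I - A i - B i. \<exists>b\<in>B i. ((i, b), (i, j)) \<in> parcs D" if "i \<in> ?I" for i
    using dom_rest by metis
  obtain C where C: "C j \<subseteq> ?I" "real (card (C j)) \<le> ?L"
    "\<forall>i\<in>?I - C j. \<exists>c\<in>C j. ((c, j), (i, j)) \<in> parcs D" if "j \<in> ?I" for j
    using dom_col by metis
  define S where "S = (\<Union>i\<in>?I. Pair i ` (A i \<union> B i)) \<union> (\<Union>j\<in>?I. (\<lambda>i. (i, j)) ` C j)"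
  have row_card: "real (card (Pair i ` (A i \<union> B i))) \<le> 2 * ?L" if "i \<in> ?I" for i
  proof -
    have "card (Pair i ` (A i \<union> B i)) \<le> card (A i) + card (B i)"
      by (metis card_Un_le card_image inj_on_def prod.inject)
    then show ?thesis using A(2)[OF that] B(2)[OF that] by linarith
  qed
  have col_card: "real (card ((\<lambda>i. (i, j)) ` C j)) \<le> ?L" if "j \<in> ?I" for j
    using C(2)[OF that] by (simp add: card_image inj_on_def)
  have "card S \<le> card (\<Union>i\<in>?I. Pair i ` (A i \<union> B i)) + card (\<Union>j\<in>?I. (\<lambda>i. (i, j)) ` C j)"
    unfolding S_def by (rule card_Un_le)
  also have "\<dots> \<le> (\<Sum>i\<in>?I. card (Pair i ` (A i \<union> B i))) + (\<Sum>j\<in>?I. card ((\<lambda>i. (i, j)) ` C j))"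
    by (intro add_mono card_UN_le) auto
  finally have "real (card S) \<le> (\<Sum>i\<in>?I. real (card (Pair i ` (A i \<union> B i))))
      + (\<Sum>j\<in>?I. real (card ((\<lambda>i. (i, j)) ` C j)))"
    by (simp only: of_nat_le_iff flip: of_nat_sum of_nat_add)
  also have "\<dots> \<le> (\<Sum>i\<in>?I. 2 * ?L) + (\<Sum>j\<in>?I. ?L)"
    by (intro add_mono sum_mono row_card col_card)
  also have "\<dots> = 3 * real m * ?L" by simp
  finally have card: "real (card S) \<le> 3 * real m * ?L" .

  have S_iff: "(i, j) \<in> S \<longleftrightarrow> i \<in> ?I \<and> j \<in> A i \<union> B i \<or> j \<in> ?I \<and> i \<in> C j" for i j
    unfolding S_def by blast
  have two_row: "\<exists>a b. a \<noteq> b \<and> (i, a) \<in> S \<and> (i, b) \<in> S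
      \<and> ((i, a), (i, j)) \<in> parcs D \<and> ((i, b), (i, j)) \<in> parcs D"
    if "(i, j) \<in> pverts D - S" for i j
  proof -
    have i: "i \<in> ?I" and "j \<in> ?I - A i - B i" using that by (auto simp: S_iff vD)
    then obtain a b where "a \<in> A i" "b \<in> B i" "((i, a), (i, j)) \<in> parcs D" "((i, b), (i, j)) \<in> parcs D"
      using A(3)[OF i] B(3)[OF i] by blast
    moreover from this have "a \<noteq> b" using B(1)[OF i] by blast
    ultimately show ?thesis using i unfolding S_iff by blast
  qed
  have one_col: "\<exists>c. (c, j) \<in> S \<and> ((c, j), (i, j)) \<in> parcs D"
    if "(i, j) \<in> pverts D - S" for i j
  proof -
    have j: "j \<in> ?I" and "i \<in> ?I - C j" using that by (auto simp: S_iff vD)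
    then obtain c where "c \<in> C j" "((c, j), (i, j)) \<in> parcs D" using C(3)[OF j] by blast
    then show ?thesis using j unfolding S_iff by blast
  qed
  have located: "(i, j) = (i', j')"
    if u: "(i, j) \<in> pverts D - S" and v: "(i', j') \<in> pverts D - S"
      and eq: "in_neighbours D (i, j) \<inter> S = in_neighbours D (i', j') \<inter> S" for i j i' j'
  proof -
    have transfer: "((a, b), (i', j')) \<in> parcs D" if "(a, b) \<in> S" "((a, b), (i, j)) \<in> parcs D" for a b
      using eq that unfolding in_neighbours_def by blast
    obtain a b where "a \<noteq> b" "((i, a), (i', j')) \<in> parcs D" "((i, b), (i', j')) \<in> parcs D"
      using two_row[OF u] transfer by blast
    \<comment> \<open>If \<open>i \<noteq> i'\<close>, adjacency to \<open>(i', j')\<close> would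
      force both \<open>a = j'\<close> and \<open>b = j'\<close>, against
      \<open>a \<noteq> b\<close>.\<close>
    then have "i = i'" using adj by metis
    moreover obtain c where "((c, j), (i, j)) \<in> parcs D" "((c, j), (i', j')) \<in> parcs D"
      using one_col[OF u] transfer by blast
    \<comment> \<open>The arc into \<open>(i, j)\<close> joins distinct vertices of one column, so
      \<open>c \<noteq> i\<close>. With \<open>i = i'\<close>, the arc into \<open>(i', j')\<close>
      must then stay in column \<open>j\<close>, whence \<open>j = j'\<close>.\<close>
    ultimately show ?thesis using adj by metis
  qed
  have "S \<subseteq> pverts D" using A(1) B(1) C(1) by (fastforce simp: S_def vD)
  moreover have "in_neighbours D u \<inter> S \<noteq> {}" if "u \<in> pverts D - S" for u
    using one_col[of "fst u" "snd u"] that by (auto simp: in_neighbours_def)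
  ultimately have "locating_dominating D S"
    unfolding locating_dominating_def using located by (metis surj_pair)
  then show ?thesis using card by blast
qed

theorem theorem42:
  fixes m :: nat
  assumes "m \<ge> 1"
  shows "m \<le> Gamma_LD (complete_pair_graph m \<box> complete_pair_graph m) \<and>
    real (Gamma_LD (complete_pair_graph m \<box> complete_pair_graph m))
      \<le> 3 * real m * log 2 (real m + 1)"
proof -
  let ?G = "complete_pair_graph m \<box> complete_pair_graph m"
  \<comment> \<open>Finiteness and nonemptiness give \<open>Max\<close> in \<open>Gamma_LD\<close>
    its meaning.\<close>
  note orient = finite_nonempty_orientations[OF pair_graph_complete_box_complete[of m]]
  have fin: "finite (pverts D)" if "orientation_of D ?G" for D
    using that by (simp add: orientation_of_def pverts_complete_box_complete)
  \<comment> \<open>For the lower bound any single orientation will do, since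
    \<open>Gamma_LD\<close> is a maximum.\<close>
  obtain D where D: "orientation_of D ?G" using orient(2) by blast
  have "m \<le> gamma_LD D"
    unfolding gamma_LD_def
    using finite_nonempty_locating_dominating[OF fin[OF D]] locating_dominating_card_ge[OF D]
    by (subst Min_ge_iff) auto
  also have "gamma_LD D \<le> Gamma_LD ?G"
    unfolding Gamma_LD_def using orient(1) D by (intro Max_ge) auto
  finally have lower: "m \<le> Gamma_LD ?G" .
  \<comment> \<open>For the upper bound the maximum is realised by some orientation, to which the
    construction of a small set applies.\<close>
  have "Gamma_LD ?G \<in> {gamma_LD D | D. orientation_of D ?G}"
    unfolding Gamma_LD_def using orient by (rule Max_in)
  then obtain D' where D': "orientation_of D' ?G" "Gamma_LD ?G = gamma_LD D'" by blast
  obtain S where S: "locating_dominating D' S" "real (card S) \<le> 3 * real m * log 2 (real m + 1)"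
    using exists_small_locating_dominating[OF D'(1)] by blast
  have "gamma_LD D' \<le> card S"
    unfolding gamma_LD_def
    using finite_nonempty_locating_dominating(1)[OF fin[OF D'(1)]] S(1) by (intro Min_le) auto
  then have "real (Gamma_LD ?G) \<le> 3 * real m * log 2 (real m + 1)"
    using S(2) D'(2) by linarith
  with lower show ?thesis by blast
qed

end
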